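(* Let $k\ge1$ and $n>k$ be integers. Then $$\mathrm{iidLP}^{\mathsf{ST}/\mathsf{Proph}}_{k,n}=\sup_{\tau\in(0,1]}\mathrm{iidLP}^{\mathsf{OST}(\tau)/\mathsf{Proph}}_{k,n}\qquad\text{and}\qquad \mathrm{iidLP}^{\mathsf{ST}/\mathsf{ExAnte}}_{k,n}=\sup_{\tau\in(0,1]}\mathrm{iidLP}^{\mathsf{OST}(\tau)/\mathsf{ExAnte}}_{k,n}.$$
   Context: $[n]=\{1,\dots,n\}$; $\mathrm{Bin}(n,q)$ is a Binomial random variable with $n$ trials and success probability $q$. $\mathcal P^k_n$ is the set of pairs $(\mathbf x,\mathbf y)$ of real arrays $\mathbf x=(x^l_i)_{i\in[n],l\in[k]}$, $\mathbf y=(y^l_i)_{i\in[n],l\in[k]}$ such that $0\le y^l_i\le x^l_i$ for all $i,l$; $x^k_1=1$; $x^l_1=0$ for $l<k$; and $x^l_i=x^l_{i-1}-y^l_{i-1}+y^{l+1}_{i-1}$ for all $i>1$, $l\in[k]$, with the convention $y^{k+1}_{i}=0$. For $\tau\in(0,1]$ let $(\mathbf x(\tau),\mathbf y(\tau))$ be the unique element of $\mathcal P^k_n$ with $y^l_i(\tau)=\tau x^l_i(\tau)$ for all $i,l$. Put $Q(q)=\mathbb E[\min\{\mathrm{Bin}(n,q),k\}]$ in problems with superscript "$/\mathsf{Proph}$" and $Q(q)=\min\{nq,k\}$ in those with superscript "$/\mathsf{ExAnte}$". $\mathrm{iidLP}^{\mathsf{OST}(\tau)/\cdot}_{k,n}$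 is the largest real $\theta$ such that $\theta\cdot Q(q)\le\sum_{i=1}^n\sum_{l=1}^k\min\{y^l_i(\tau),qx^l_i(\tau)\}$ for all $q\in(0,1]$. $\mathrm{iidLP}^{\mathsf{ST}/\cdot}_{k,n}$ is the supremum of $\theta$ over real $\theta$ and probability measures $\mu$ on $(0,1]$ subject to $\theta\cdot Q(q)\le\int_{(0,1]}\big(\sum_{i=1}^n\sum_{l=1}^k\min\{y^l_i(\tau),qx^l_i(\tau)\}\big)d\mu(\tau)$ for all $q\in(0,1]$. *)

theory Defs
  imports "HOL-Probability.Probability"
begin

text \<open>
  An array \<open>(x\<^sup>l\<^sub>i)\<close> with \<open>i \<in> {1..n}\<close>, \<open>l \<in> {1..k}\<close> is a function applied as \<open>x l i\<close> that
  vanishes outside the index range. This makes equality of arrays the equality of functions, and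
  it yields the convention \<open>y\<^bsup>k+1\<^esup>\<^sub>i = 0\<close> in the recurrence.
\<close>

type_synonym array = "nat \<Rightarrow> nat \<Rightarrow> real"

definition is_array :: "nat \<Rightarrow> nat \<Rightarrow> array \<Rightarrow> bool" where
  "is_array k n x \<longleftrightarrow> (\<forall>l i. \<not> (l \<in> {1..k} \<and> i \<in> {1..n}) \<longrightarrow> x l i = 0)"

definition polytope_P :: "nat \<Rightarrow> nat \<Rightarrow> (array \<times> array) set" where
  "polytope_P k n = {(x, y).
     is_array k n x \<and> is_array k n y \<and>
     (\<forall>i\<in>{1..n}. \<forall>l\<in>{1..k}. 0 \<le> y l i \<and> y l i \<le> x l i) \<and>
     x k 1 = 1 \<and>
     (\<forall>l\<in>{1..<k}. x l 1 = 0) \<and>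
     (\<forall>i\<in>{2..n}. \<forall>l\<in>{1..k}. x l i = x l (i - 1) - y l (i - 1) + y (l + 1) (i - 1))}"

definition static_xy :: "nat \<Rightarrow> nat \<Rightarrow> real \<Rightarrow> array \<times> array" where
  "static_xy k n \<tau> =
     (THE p. p \<in> polytope_P k n \<and> (\<forall>i\<in>{1..n}. \<forall>l\<in>{1..k}. snd p l i = \<tau> * fst p l i))"

definition static_x :: "nat \<Rightarrow> nat \<Rightarrow> real \<Rightarrow> array" where
  "static_x k n \<tau> = fst (static_xy k n \<tau>)"

definition static_y :: "nat \<Rightarrow> nat \<Rightarrow> real \<Rightarrow> array" where
  "static_y k n \<tau> = snd (static_xy k n \<tau>)"

definition static_value :: "nat \<Rightarrow> nat \<Rightarrow> real \<Rightarrow> real \<Rightarrow> real" where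
  "static_value k n \<tau> q =
     (\<Sum>i=1..n. \<Sum>l=1..k. min (static_y k n \<tau> l i) (q * static_x k n \<tau> l i))"

definition Q_Proph :: "nat \<Rightarrow> nat \<Rightarrow> real \<Rightarrow> real" where
  "Q_Proph k n q = measure_pmf.expectation (binomial_pmf n q) (\<lambda>j. real (min j k))"

definition Q_ExAnte :: "nat \<Rightarrow> nat \<Rightarrow> real \<Rightarrow> real" where
  "Q_ExAnte k n q = min (real n * q) (real k)"

definition iidLP_OST :: "(nat \<Rightarrow> nat \<Rightarrow> real \<Rightarrow> real) \<Rightarrow> nat \<Rightarrow> nat \<Rightarrow> real \<Rightarrow> real" where
  "iidLP_OST Q k n \<tau> =
     (GREATEST \<theta>. \<forall>q\<in>{0<..1}. \<theta> * Q k n q \<le> static_value k n \<tau> q)"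

definition iidLP_ST :: "(nat \<Rightarrow> nat \<Rightarrow> real \<Rightarrow> real) \<Rightarrow> nat \<Rightarrow> nat \<Rightarrow> real" where
  "iidLP_ST Q k n =
     Sup {\<theta>. \<exists>\<mu> :: real measure.
            prob_space \<mu> \<and> sets \<mu> = sets (restrict_space borel {0<..1}) \<and>
            (\<forall>q\<in>{0<..1}. \<theta> * Q k n q \<le> (\<integral>\<tau>. static_value k n \<tau> q \<partial>\<mu>))}"

subsection \<open>Well-definedness of the static arrays\<close>

primrec capacity_prob :: "nat \<Rightarrow> real \<Rightarrow> nat \<Rightarrow> nat \<Rightarrow> real" where
  "capacity_prob k \<tau> 0 l = (if l = k then 1 else 0)"
| "capacity_prob k \<tau> (Suc i) l =
     capacity_prob k \<tau> i l - \<tau> * capacity_prob k \<tau> i l + \<tau> * capacity_prob k \<tau> i (Suc l)"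

lemma capacity_prob_eq_0: "k < l \<Longrightarrow> capacity_prob k \<tau> i l = 0"
  by (induction i arbitrary: l) auto

lemma capacity_prob_nonneg:
  assumes "0 \<le> \<tau>" "\<tau> \<le> 1"
  shows "0 \<le> capacity_prob k \<tau> i l"
proof (induction i arbitrary: l)
  case (Suc i)
  have "0 \<le> (1 - \<tau>) * capacity_prob k \<tau> i l + \<tau> * capacity_prob k \<tau> i (Suc l)"
    using assms Suc by (intro add_nonneg_nonneg mult_nonneg_nonneg) auto
  then show ?case by (simp add: algebra_simps)
qed auto

lemma static_xy_ex1:
  assumes "1 \<le> k" "1 \<le> n" "\<tau> \<in> {0<..1}"
  shows "\<exists>!p. p \<in> polytope_P k n \<and> (\<forall>i\<in>{1..n}. \<forall>l\<in>{1..k}. snd p l i = \<tau> * fst p l i)"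
proof (rule ex_ex1I)
  define x :: array where
    "x = (\<lambda>l i. if l \<in> {1..k} \<and> i \<in> {1..n} then capacity_prob k \<tau> (i - 1) l else 0)"
  define y :: array where "y = (\<lambda>l i. \<tau> * x l i)"
  have nonneg: "0 \<le> x l i" for l i
    using assms by (simp add: x_def capacity_prob_nonneg)
  have rec: "x l i = x l (i - 1) - y l (i - 1) + y (l + 1) (i - 1)"
    if i: "i \<in> {2..n}" and l: "l \<in> {1..k}" for l i
  proof -
    obtain j where j: "i = Suc (Suc j)"
      using i by (auto simp: Suc_le_eq numeral_2_eq_2 dest!: less_imp_Suc_add)
    show ?thesis
      using i l by (cases "l = k") (auto simp: x_def y_def j capacity_prob_eq_0)
  qed
  have bounds: "0 \<le> y l i \<and> y l i \<le> x l i" for l i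
    using assms nonneg[of l i] by (simp add: y_def mult_left_le_one_le)
  have arr: "is_array k n x" "is_array k n y"
    by (simp_all add: is_array_def x_def y_def)
  have init: "x k 1 = 1" "\<forall>l\<in>{1..<k}. x l 1 = 0"
    using assms by (auto simp: x_def)
  have "(x, y) \<in> polytope_P k n"
    unfolding polytope_P_def using rec bounds arr init by blast
  then show "\<exists>p. p \<in> polytope_P k n \<and> (\<forall>i\<in>{1..n}. \<forall>l\<in>{1..k}. snd p l i = \<tau> * fst p l i)"
    by (intro exI[of _ "(x, y)"]) (auto simp: y_def)
next
  fix p p'
  assume p: "p \<in> polytope_P k n \<and> (\<forall>i\<in>{1..n}. \<forall>l\<in>{1..k}. snd p l i = \<tau> * fst p l i)"
    and p': "p' \<in> polytope_P k n \<and> (\<forall>i\<in>{1..n}. \<forall>l\<in>{1..k}. snd p' l i = \<tau> * fst p' l i)"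
  obtain x y x' y' where e: "p = (x, y)" "p' = (x', y')" by (cases p, cases p')
  have Y: "y l i = \<tau> * x l i" "y' l i = \<tau> * x' l i" for l i
    using p p' by (cases "l \<in> {1..k} \<and> i \<in> {1..n}"; simp add: e polytope_P_def is_array_def)+
  have eq0: "x l i = x' l i" if "\<not> (l \<in> {1..k} \<and> i \<in> {1..n})" for l i
    using p p' that by (auto simp: e polytope_P_def is_array_def)
  have eq: "x l (Suc i) = x' l (Suc i)" if "Suc i \<le> n" for l i
    using that
  proof (induction i arbitrary: l)
    case 0
    show ?case
    proof (cases "l \<in> {1..k}")
      case True
      then show ?thesis
        using p p' by (cases "l = k") (auto simp: e polytope_P_def)
    qed (use eq0 in auto)
  next
    case (Suc i)
    have IH: "x m (Suc i) = x' m (Suc i)" for m using Suc by auto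
    show ?case
    proof (cases "l \<in> {1..k}")
      case True
      have i2: "Suc (Suc i) \<in> {2..n}" using Suc.prems by auto
      have "x l (Suc (Suc i)) = x l (Suc i) - y l (Suc i) + y (l + 1) (Suc i)"
        using p True i2 unfolding e polytope_P_def by fastforce
      moreover have "x' l (Suc (Suc i)) = x' l (Suc i) - y' l (Suc i) + y' (l + 1) (Suc i)"
        using p' True i2 unfolding e polytope_P_def by fastforce
      ultimately show ?thesis by (simp add: Y IH)
    qed (use eq0 in auto)
  qed
  have "x l i = x' l i" for l i
    using eq0[of l i] eq[of "i - 1" l] by (cases "i \<in> {1..n}") auto
  then have "x = x'" by blast
  moreover from this have "y = y'" by (intro ext) (simp add: Y)
  ultimately show "p = p'" by (simp add: e)
qed

end

theory Submission
  imports Defs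
begin

text \<open>
  Let \<open>S(\<tau>)\<close> (\<open>active_time\<close>) be the expected number of steps before the capacity is exhausted, so
  that \<open>static_value k n \<tau> q = min \<tau> q * S(\<tau>)\<close> and \<open>\<tau> * S(\<tau>) = E min(Bin(n,\<tau>), k)\<close>. For both
  benchmarks, \<open>Q(q) \<le> min(n q, k)\<close> with equality to first order as \<open>q \<rightarrow> 0\<close> and equality at \<open>q = 1\<close>,
  so only the constraints \<open>q \<rightarrow> 0\<close> and \<open>q = 1\<close> matter. The optimum is \<open>S(k/n) / n\<close>: the function
  \<open>1 / S\<close> is convex, and its tangent at \<open>k/n\<close> provides nonnegative multipliers for these two
  constraints that bound every mixture by the deterministic policy \<open>k/n\<close>.

  With \<open>H = P(Bin(n-1,\<tau>) < k)\<close>, \<open>T = P(Bin(n,\<tau>) > k)\<close>, \<open>b = P(Bin(n-1,\<tau>) = k)\<close> and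
  \<open>F = E min(Bin(n,\<tau>), k) = n \<tau> H + k T\<close>, one has \<open>F' = n H\<close> and \<open>T' = n b\<close>, so convexity of
  \<open>1 / S = \<tau> / F\<close> amounts to \<open>2 H T \<le> b F\<close>. This follows by adding the estimates
  \<open>(k + 1 - n \<tau>) T \<le> (1 - \<tau>) n \<tau> b\<close> and \<open>((n-1) \<tau> - k + 1) H \<le> (1 - \<tau>) k b\<close>, obtained from
  truncated sums of \<open>j - E Bin\<close> against the binomial weights.
\<close>

subsection \<open>Binomial probabilities and tails\<close>

lemma Bernstein_eq_0: "n < j \<Longrightarrow> Bernstein n j x = 0"
  by (simp add: Bernstein_def)

lemma Bernstein_Suc_Suc:
  "Bernstein (Suc n) (Suc j) x = (1 - x) * Bernstein n (Suc j) x + x * Bernstein n j x"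
proof (cases "j < n")
  case True
  then have "n - j = Suc (n - Suc j)" by simp
  then show ?thesis by (simp add: Bernstein_def algebra_simps)
next
  case False
  then show ?thesis by (cases "j = n") (simp_all add: Bernstein_def binomial_eq_0)
qed

lemma Bernstein_Suc_0: "Bernstein (Suc n) 0 x = (1 - x) * Bernstein n 0 x"
  by (simp add: Bernstein_def)

text \<open>The ratio of consecutive binomial weights, cross-multiplied so that it also covers
  \<open>x = 1\<close> and \<open>n \<le> j\<close>. It drives the telescoping in
  \<open>sum_centered_Bernstein\<close>.\<close>

lemma Bernstein_index_shift:
  "(1 - x) * (real (Suc j) * Bernstein n (Suc j) x) = x * ((real n - real j) * Bernstein n j x)"
proof (cases "j < n")
  case True
  then have n: "n - j = Suc (n - Suc j)" by simp
  have "Suc j * (n choose Suc j) = (n - j) * (n choose j)"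
    using binomial_absorb_comp[of n j] binomial_absorption[of j n] by simp
  then have "real (Suc j) * real (n choose Suc j) = (real n - real j) * real (n choose j)"
    using True by (metis less_imp_le of_nat_diff of_nat_mult)
  then show ?thesis by (simp add: Bernstein_def n del: of_nat_Suc)
next
  case False
  then show ?thesis by (cases "j = n") (simp_all add: Bernstein_def binomial_eq_0)
qed

text \<open>Size biasing of the binomial law: weighting by the number of successes removes one trial
  and one success. It links \<open>Suc n\<close> trials to \<open>n\<close> trials.\<close>

lemma Bernstein_absorption:
  "real (Suc j) * Bernstein (Suc n) (Suc j) x = real (Suc n) * x * Bernstein n j x"
proof -
  have "real (Suc j) * real (Suc n choose Suc j) = real (Suc n) * real (n choose j)"
    using Suc_times_binomial_eq[of n j] by (metis mult.commute of_nat_mult)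
  then show ?thesis by (simp add: Bernstein_def del: of_nat_Suc binomial_Suc_Suc)
qed

text \<open>Differences of neighbouring weights of one degree lower make sums over consecutive
  indices telescope. The case distinction treats a weight of index -1 as 0.\<close>

lemma DERIV_Bernstein:
  "((\<lambda>x. Bernstein (Suc n) j x) has_real_derivative
     real (Suc n) * ((case j of 0 \<Rightarrow> 0 | Suc i \<Rightarrow> Bernstein n i x) - Bernstein n j x)) (at x)"
proof (induction n arbitrary: j)
  case 0
  show ?case
    by (cases j)
      (auto simp: Bernstein_Suc_Suc Bernstein_Suc_0 Bernstein_def binomial_eq_0_iff split: nat.splits
        intro!: derivative_eq_intros)
next
  case (Suc n)
  show ?case
  proof (cases j)
    case 0
    show ?thesis
      unfolding 0 Bernstein_Suc_0[of "Suc n"]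
      by (rule derivative_eq_intros Suc refl)+ (simp add: Bernstein_Suc_0 algebra_simps)
  next
    case j: (Suc i)
    show ?thesis
      unfolding j Bernstein_Suc_Suc[of "Suc n"]
      by (rule derivative_eq_intros Suc refl)+
        (cases i; simp add: Bernstein_Suc_0 Bernstein_Suc_Suc algebra_simps)
  qed
qed

section \<open>Tails, truncated means and the active time\<close>

definition binomial_tail :: "nat \<Rightarrow> nat \<Rightarrow> real \<Rightarrow> real" where
  "binomial_tail n k x = (\<Sum>j\<in>{k<..n}. Bernstein n j x)"

definition binomial_head :: "nat \<Rightarrow> nat \<Rightarrow> real \<Rightarrow> real" where
  "binomial_head n k x = (\<Sum>j<k. Bernstein n j x)"

definition expected_min :: "nat \<Rightarrow> nat \<Rightarrow> real \<Rightarrow> real" where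
  "expected_min n k x = (\<Sum>j\<le>n. real (min j k) * Bernstein n j x)"

text \<open>Summand \<open>i\<close> is the probability that the first \<open>i\<close> trials leave
  some capacity for step \<open>i + 1\<close>.\<close>

definition active_time :: "nat \<Rightarrow> nat \<Rightarrow> real \<Rightarrow> real" where
  "active_time n k x = (\<Sum>i<n. binomial_head i k x)"

lemma binomial_head_nonneg: "0 \<le> x \<Longrightarrow> x \<le> 1 \<Longrightarrow> 0 \<le> binomial_head n k x"
  by (simp add: binomial_head_def sum_nonneg Bernstein_nonneg)

lemma binomial_tail_nonneg: "0 \<le> x \<Longrightarrow> x \<le> 1 \<Longrightarrow> 0 \<le> binomial_tail n k x"
  by (simp add: binomial_tail_def sum_nonneg Bernstein_nonneg)

lemma binomial_head_le_1:
  assumes "0 \<le> x" "x \<le> 1"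
  shows "binomial_head n k x \<le> 1"
proof -
  \<comment> \<open>Early summands of \<open>active_time\<close> have fewer trials than
    \<open>k\<close>; indices above \<open>n\<close> carry weight 0.\<close>
  have "binomial_head n k x = (\<Sum>j\<in>{..<k} \<inter> {..n}. Bernstein n j x)"
    unfolding binomial_head_def by (rule sum.mono_neutral_right) (auto intro: leI dest: Bernstein_eq_0[of n _ x])
  also have "\<dots> \<le> (\<Sum>j\<le>n. Bernstein n j x)"
    by (rule sum_mono2) (use assms in \<open>auto simp: Bernstein_nonneg\<close>)
  finally show ?thesis by simp
qed

lemma binomial_tail_rec: "binomial_tail n k x = Bernstein n (Suc k) x + binomial_tail n (Suc k) x"
proof (cases "k < n")
  case True
  then have "{k<..n} = insert (Suc k) {Suc k<..n}" by auto
  then show ?thesis by (simp add: binomial_tail_def)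
qed (simp add: binomial_tail_def Bernstein_eq_0)

text \<open>One more trial lifts the count above \<open>k\<close> exactly when the first
  \<open>n\<close> trials give \<open>k\<close> successes and the new one succeeds.\<close>

lemma binomial_tail_Suc: "binomial_tail (Suc n) k x = binomial_tail n k x + x * Bernstein n k x"
\<comment> \<open>Downward induction on \<open>k\<close>, starting from \<open>n < k\<close>, where
  both sides vanish.\<close>
proof (induction "Suc n - k" arbitrary: k)
  case 0
  then show ?case by (simp add: binomial_tail_def Bernstein_eq_0)
next
  case (Suc d)
  from Suc(1)[of "Suc k"] Suc(2) show ?case
    by (simp add: binomial_tail_rec[of _ k] Bernstein_Suc_Suc algebra_simps)
qed

text \<open>The derivatives of the weights telescope and leave the boundary term at index
  \<open>k\<close>.\<close>

lemma DERIV_binomial_tail: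
  "((\<lambda>x. binomial_tail (Suc n) k x) has_real_derivative real (Suc n) * Bernstein n k x) (at x)"
proof (induction "Suc n - k" arbitrary: k)
  case 0
  then show ?case by (simp add: binomial_tail_def Bernstein_eq_0)
next
  case (Suc d)
  have IH: "((\<lambda>x. binomial_tail (Suc n) (Suc k) x) has_real_derivative
      real (Suc n) * Bernstein n (Suc k) x) (at x)"
    using Suc by simp
  show ?case unfolding binomial_tail_rec[of _ k]
    by (rule derivative_eq_intros IH DERIV_Bernstein refl)+ (simp add: algebra_simps)
qed

text \<open>Layer-cake formula: min(X, k) counts the j < k with j < X.\<close>

lemma expected_min_eq_sum_tail: "expected_min n k x = (\<Sum>j<k. binomial_tail n j x)"
proof (induction k)
  case (Suc k)
  have "real (min j (Suc k)) = real (min j k) + of_bool (k < j)" for j by auto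
  then have "expected_min n (Suc k) x =
      expected_min n k x + (\<Sum>j\<le>n. of_bool (k < j) * Bernstein n j x)"
    by (simp add: expected_min_def distrib_right sum.distrib)
  also have "(\<Sum>j\<le>n. of_bool (k < j) * Bernstein n j x) = binomial_tail n k x"
    unfolding binomial_tail_def by (rule sum.mono_neutral_cong_right) auto
  finally show ?case using Suc by simp
qed (simp add: expected_min_def)

lemma DERIV_expected_min:
  "((\<lambda>x. expected_min (Suc n) k x) has_real_derivative real (Suc n) * binomial_head n k x) (at x)"
  unfolding expected_min_eq_sum_tail binomial_head_def sum_distrib_left
  by (intro DERIV_sum DERIV_binomial_tail)

text \<open>The split of min(X, k) into X on X <= k and k on X > k; size biasing turns the first
  part into a head probability for \<open>n\<close> trials.\<close>

lemma expected_min_decomp: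
  "expected_min (Suc n) k x =
     real (Suc n) * x * binomial_head n k x + real k * binomial_tail (Suc n) k x"
proof (induction k)
  case (Suc k)
  have "expected_min (Suc n) (Suc k) x =
      expected_min (Suc n) k x + binomial_tail (Suc n) k x"
    by (simp add: expected_min_eq_sum_tail)
  then show ?case
    using Suc Bernstein_absorption[of k n x] binomial_tail_rec[of "Suc n" k x]
    by (simp add: binomial_head_def algebra_simps)
qed (simp add: expected_min_eq_sum_tail binomial_head_def)

text \<open>A Wald-type identity. Success j + 1 comes at trial i + 1 exactly when the first i trials
  give j successes and the next one succeeds; summing over i < n gives P(X > j).\<close>

lemma expected_min_eq_active_time: "expected_min n k x = x * active_time n k x"
proof -
  have "binomial_tail n j x = (\<Sum>i<n. x * Bernstein i j x)" for j
  proof (induction n)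
    case (Suc n) then show ?case by (simp add: binomial_tail_Suc)
  qed (simp add: binomial_tail_def)
  then show ?thesis
    unfolding expected_min_eq_sum_tail active_time_def binomial_head_def sum_distrib_left
    by (simp add: sum.swap[of _ "{..<n}"])
qed

lemma expected_min_le:
  assumes "0 \<le> x" "x \<le> 1"
  shows "expected_min n k x \<le> real k"
proof -
  have "expected_min n k x \<le> (\<Sum>j\<le>n. real k * Bernstein n j x)"
    unfolding expected_min_def using assms
    by (intro sum_mono mult_right_mono) (auto simp: Bernstein_nonneg)
  then show ?thesis by (simp flip: sum_distrib_left)
qed

lemma expected_min_1: "k \<le> n \<Longrightarrow> expected_min n k 1 = real k"
proof -
  assume "k \<le> n"
  have "expected_min n k 1 = (\<Sum>j\<in>{n}. real (min j k) * Bernstein n j 1)"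
    unfolding expected_min_def
    by (rule sum.mono_neutral_right) (auto simp: Bernstein_def)
  then show ?thesis using \<open>k \<le> n\<close> by (simp add: Bernstein_def)
qed

lemma active_time_pos:
  assumes "1 \<le> k" "1 \<le> n" "0 \<le> x" "x \<le> 1"
  shows "0 < active_time n k x"
proof -
  have "binomial_head 0 k x = (\<Sum>j\<in>{0}. Bernstein 0 j x)"
    unfolding binomial_head_def using assms
    by (intro sum.mono_neutral_right) (auto simp: Bernstein_eq_0)
  then have "binomial_head 0 k x = 1" by (simp add: Bernstein_def)
  moreover have "binomial_head 0 k x \<le> active_time n k x"
    unfolding active_time_def using assms
    by (intro member_le_sum) (auto simp: binomial_head_nonneg)
  ultimately show ?thesis by simp
qed

lemma active_time_le:
  assumes "0 \<le> x" "x \<le> 1"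
  shows "active_time n k x \<le> real n"
  using sum_mono[of "{..<n}" "\<lambda>i. binomial_head i k x" "\<lambda>_. 1"] assms
  by (simp add: active_time_def binomial_head_le_1)

lemma active_time_0:
  assumes "1 \<le> k"
  shows "active_time n k 0 = real n"
proof -
  have "binomial_head i k 0 = 1" for i
  proof -
    have "binomial_head i k 0 = (\<Sum>j\<in>{0}. Bernstein i j 0)"
      unfolding binomial_head_def using assms
      by (intro sum.mono_neutral_right) (auto simp: Bernstein_def)
    then show ?thesis by (simp add: Bernstein_def)
  qed
  then show ?thesis by (simp add: active_time_def)
qed

lemma continuous_on_active_time: "continuous_on A (active_time n k)"
  unfolding active_time_def binomial_head_def Bernstein_def by (intro continuous_intros)

subsection \<open>Convexity of the reciprocal active time\<close>

text \<open>The truncated centred first moment telescopes by \<open>Bernstein_index_shift\<close>,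
  leaving one boundary weight.\<close>

lemma sum_centered_Bernstein:
  "(\<Sum>j<k. (real n * x - real j) * Bernstein n j x) = (1 - x) * (real k * Bernstein n k x)"
proof (induction k)
  case (Suc k)
  then show ?case using Bernstein_index_shift[of x k n] by (simp add: algebra_simps)
qed simp

text \<open>For j < k the centred factor n x - j is at least n x - k + 1, whatever the sign of the
  latter.\<close>

lemma binomial_head_mass_bound:
  assumes "0 \<le> x" "x \<le> 1"
  shows "(real n * x - real k + 1) * binomial_head n k x \<le> (1 - x) * (real k * Bernstein n k x)"
proof -
  have "(real n * x - real k + 1) * binomial_head n k x
      \<le> (\<Sum>j<k. (real n * x - real j) * Bernstein n j x)"
    unfolding binomial_head_def sum_distrib_left using assms
    by (intro sum_mono mult_right_mono) (auto simp: Bernstein_nonneg)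
  then show ?thesis by (simp only: sum_centered_Bernstein)
qed

text \<open>The mirror image: for j > k the factor j - n x is at least k + 1 - n x, and the upper
  centred sum is the full one subtracted from the lower one.\<close>

lemma binomial_tail_mass_bound:
  assumes "0 \<le> x" "x \<le> 1"
  shows "(real k + 1 - real n * x) * binomial_tail n k x
    \<le> (1 - x) * (real (Suc k) * Bernstein n (Suc k) x)"
proof (cases "k < n")
  case True
  have "(real k + 1 - real n * x) * binomial_tail n k x
      \<le> (\<Sum>j\<in>{k<..n}. (real j - real n * x) * Bernstein n j x)"
    unfolding binomial_tail_def sum_distrib_left using assms
    by (intro sum_mono mult_right_mono) (auto simp: Bernstein_nonneg)
  also have "\<dots> = (\<Sum>j<Suc k. (real n * x - real j) * Bernstein n j x)
      - (\<Sum>j<Suc n. (real n * x - real j) * Bernstein n j x)"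
  proof -
    have "{..<Suc n} = {..<Suc k} \<union> {k<..n}" using True by auto
    moreover have "{..<Suc k} \<inter> {k<..n} = {}" by auto
    ultimately have "(\<Sum>j<Suc n. (real n * x - real j) * Bernstein n j x)
        = (\<Sum>j<Suc k. (real n * x - real j) * Bernstein n j x)
          + (\<Sum>j\<in>{k<..n}. (real n * x - real j) * Bernstein n j x)"
      by (simp add: sum.union_disjoint del: sum.lessThan_Suc)
    then show ?thesis
      by (simp add: sum_negf[symmetric] algebra_simps del: sum.lessThan_Suc sum_negf)
  qed
  \<comment> \<open>The full centred sum vanishes, because its boundary weight has index n +
    1.\<close>
  also have "\<dots> = (1 - x) * (real (Suc k) * Bernstein n (Suc k) x)"
    unfolding sum_centered_Bernstein by (simp add: Bernstein_eq_0)
  finally show ?thesis .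
qed (simp add: binomial_tail_def Bernstein_eq_0)

text \<open>The inequality behind the convexity of 1/S; \<open>n\<close> here is one less than the
  number of trials.\<close>

lemma head_tail_product_le:
  assumes "0 < x" "x \<le> 1" "k \<le> n"
  shows "2 * binomial_head n k x * binomial_tail (Suc n) k x
    \<le> Bernstein n k x * expected_min (Suc n) k x"
\<comment> \<open>The main case cancels the factor 1 - x at the end.\<close>
proof (cases "x = 1")
  case True
  have "binomial_head n k 1 = 0"
    using assms(3) by (auto simp: binomial_head_def Bernstein_def intro!: sum.neutral)
  moreover have "0 \<le> expected_min (Suc n) k 1" "0 \<le> Bernstein n k 1"
    by (simp_all add: expected_min_def Bernstein_nonneg sum_nonneg)
  ultimately show ?thesis using True by simp
next
  case False
  let ?H = "binomial_head n k x" and ?T = "binomial_tail (Suc n) k x" and ?b = "Bernstein n k x"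
  have H: "0 \<le> ?H" and T: "0 \<le> ?T"
    using assms by (simp_all add: binomial_head_nonneg binomial_tail_nonneg)
  have "(real k + 1 - real (Suc n) * x) * ?T \<le> (1 - x) * (real (Suc n) * x * ?b)"
    using binomial_tail_mass_bound[of x k "Suc n"] assms by (simp only: Bernstein_absorption)
  from mult_right_mono[OF this H]
  have 1: "(real k + 1 - real (Suc n) * x) * ?T * ?H \<le> (1 - x) * (real (Suc n) * x * ?b) * ?H" .
  have 2: "(real n * x - real k + 1) * ?H * ?T \<le> (1 - x) * (real k * ?b) * ?T"
    using binomial_head_mass_bound[of x n k] assms T by (intro mult_right_mono) auto
  \<comment> \<open>The coefficients of the two bounds add up to 2 - x = 2 (1 - x) + x; the surplus
    x H T is nonnegative and is dropped.\<close>
  have "(1 - x) * (2 * ?H * ?T) + x * (?H * ?T) =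
      (real k + 1 - real (Suc n) * x) * ?T * ?H + (real n * x - real k + 1) * ?H * ?T"
    by (simp add: algebra_simps)
  also have "\<dots> \<le> (1 - x) * (?b * expected_min (Suc n) k x)"
    using 1 2 by (simp add: expected_min_decomp algebra_simps)
  finally have "(1 - x) * (2 * ?H * ?T) + x * (?H * ?T) \<le> (1 - x) * (?b * expected_min (Suc n) k x)" .
  moreover have "0 \<le> x * (?H * ?T)" using H T assms by simp
  ultimately have "(1 - x) * (2 * ?H * ?T) \<le> (1 - x) * (?b * expected_min (Suc n) k x)" by linarith
  then show ?thesis using False assms by simp
qed

text \<open>\<alpha> and \<beta> are the intercept and slope of the tangent to 1/S at
  \<open>t\<close>; multiplying by S > 0 clears the denominators.\<close>

lemma inverse_active_time_tangent:
  assumes "1 \<le> k" "k < n" "0 < t" "t < 1"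
  obtains \<alpha> \<beta> where "0 \<le> \<alpha>" "0 \<le> \<beta>" "(\<alpha> + \<beta> * t) * active_time n k t = 1"
    "\<And>x. 0 < x \<Longrightarrow> x \<le> 1 \<Longrightarrow> (\<alpha> + \<beta> * x) * active_time n k x \<le> 1"
proof -
  obtain m where n: "n = Suc m" "k \<le> m" using assms by (cases n) auto
  define F where "F = expected_min n k"
  define T where "T = binomial_tail n k"
  define H where "H = binomial_head m k"
  define S where "S = active_time n k"
  \<comment> \<open>For \<open>x > 0\<close> this is 1/S, written as x/F because F and T have
    explicit derivatives.\<close>
  define g where "g = (\<lambda>x. x / F x)"
  define g' where "g' = (\<lambda>x. real k * T x / (F x)\<^sup>2)"
  define g'' where "g'' = (\<lambda>x. real n * real k * (Bernstein m k x * F x - 2 * H x * T x) / (F x) ^ 3)"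
  have S: "0 < S x" if "0 < x" "x \<le> 1" for x
    using that assms by (simp add: S_def active_time_pos)
  have FS: "F x = x * S x" for x by (simp add: F_def S_def expected_min_eq_active_time)
  have F: "0 < F x" if "0 < x" "x \<le> 1" for x
    using that S by (simp add: FS)
  have F_decomp: "F x = real n * x * H x + real k * T x" for x
    by (simp add: F_def T_def H_def n expected_min_decomp)
  have DF: "(F has_real_derivative real n * H x) (at x)" for x
    unfolding F_def H_def n by (rule DERIV_expected_min)
  have DT: "(T has_real_derivative real n * Bernstein m k x) (at x)" for x
    unfolding T_def n by (rule DERIV_binomial_tail)
  have Dg: "(g has_real_derivative g' x) (at x)" if "x \<in> {0<..1}" for x
  proof -
    have "F x \<noteq> 0" using F[of x] that by auto
    moreover have "1 * F x - x * (real n * H x) = real k * T x" by (simp add: F_decomp)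
    ultimately show ?thesis unfolding g_def g'_def
      using DERIV_divide[OF DERIV_ident DF, where x = x] by (simp add: power2_eq_square)
  qed
  have Dg': "(g' has_real_derivative g'' x) (at x)" if "x \<in> {0<..1}" for x
  proof -
    have "F x \<noteq> 0" using F[of x] that by auto
    then show ?thesis unfolding g'_def g''_def
      by (auto intro!: derivative_eq_intros DF DT simp: field_simps power2_eq_square power3_eq_cube)
  qed
  have "0 \<le> g'' x" if "x \<in> {0<..1}" for x
  proof -
    have "2 * H x * T x \<le> Bernstein m k x * F x"
      using head_tail_product_le[of x k m] that n by (simp add: H_def T_def F_def)
    then show ?thesis using F[of x] that by (simp add: g''_def)
  qed
  then have "convex_on {0<..1} g" using Dg Dg' by (intro f''_ge0_imp_convex) auto
  \<comment> \<open>For the later choice \<open>t = k / n\<close>, the condition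
    \<open>t < 1\<close> amounts to \<open>k < n\<close>.\<close>
  moreover have "t \<in> interior {0<..1}"
    using assms interior_maximal[of "{0<..<1}" "{0<..1::real}"] by auto
  ultimately have tangent: "g x - g t \<ge> g' t * (x - t)" if "x \<in> {0<..1}" for x
    using that assms Dg[of t]
    by (intro convex_on_imp_above_tangent[where A = "{0<..1}"])
      (auto intro: has_field_derivative_at_within)
  have Ft: "0 < F t" using F assms by simp
  show thesis
  proof (rule that[of "g t - g' t * t" "g' t"])
    \<comment> \<open>The numerator F - k T equals n t H, so the intercept is nonnegative.\<close>
    have "g t - g' t * t = t * (F t - real k * T t) / (F t)\<^sup>2"
      using Ft by (simp add: g_def g'_def field_simps power2_eq_square)
    also have "\<dots> \<ge> 0"
      using assms by (simp add: F_decomp H_def binomial_head_nonneg)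
    finally show "0 \<le> g t - g' t * t" .
    show "0 \<le> g' t"
      using assms by (simp add: g'_def T_def binomial_tail_nonneg)
    show "(g t - g' t * t + g' t * t) * active_time n k t = 1"
      using Ft assms S[of t] by (simp add: g_def FS flip: S_def)
    fix x :: real assume x: "0 < x" "x \<le> 1"
    have "g t - g' t * t + g' t * x \<le> g x"
      using tangent[of x] x by (simp add: algebra_simps)
    then have "(g t - g' t * t + g' t * x) * S x \<le> g x * S x"
      using S[OF x] by (intro mult_right_mono) auto
    also have "\<dots> = 1" using S[OF x] x by (simp add: g_def FS)
    finally show "(g t - g' t * t + g' t * x) * active_time n k x \<le> 1" by (simp add: S_def)
  qed
qed

subsection \<open>Static policies\<close>

lemma static_y_eq:
  assumes "1 \<le> k" "1 \<le> n" "\<tau> \<in> {0<..1}" "i \<in> {1..n}" "l \<in> {1..k}"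
  shows "static_y k n \<tau> l i = \<tau> * static_x k n \<tau> l i"
  using theI'[OF static_xy_ex1[OF assms(1-3)]] assms(4,5)
  by (auto simp: static_x_def static_y_def static_xy_def)

text \<open>With \<open>l\<close> units left, \<open>k - l\<close> of the first \<open>i\<close>
  trials succeeded. The recurrence of the polytope is then Pascal's rule, with the convention at
  level \<open>k + 1\<close> as the case of no success.\<close>

lemma static_x_eq_Bernstein:
  assumes "1 \<le> k" "\<tau> \<in> {0<..1}" "i < n" "l \<in> {1..k}"
  shows "static_x k n \<tau> l (Suc i) = Bernstein i (k - l) \<tau>"
proof -
  let ?x = "static_x k n \<tau>" and ?y = "static_y k n \<tau>"
  have n: "1 \<le> n" using assms by simp
  have P: "(?x, ?y) \<in> polytope_P k n"
    using theI'[OF static_xy_ex1[OF assms(1) n assms(2)]]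
    by (simp add: static_x_def static_y_def static_xy_def)
  show ?thesis
    using assms(3,4)
  proof (induction i arbitrary: l)
    case 0
    then show ?case
      using P by (cases "l = k") (auto simp: polytope_P_def Bernstein_def binomial_eq_0)
  next
    case (Suc i)
    have i: "Suc (Suc i) \<in> {2..n}" "Suc i \<in> {1..n}" using Suc.prems by auto
    have "?x l (Suc (Suc i)) = ?x l (Suc i) - ?y l (Suc i) + ?y (Suc l) (Suc i)"
      using P i(1) Suc.prems(2) unfolding polytope_P_def by fastforce
    also have "?y l (Suc i) = \<tau> * ?x l (Suc i)"
      using static_y_eq assms(1,2) n i(2) Suc.prems(2) by blast
    also have "?x l (Suc i) = Bernstein i (k - l) \<tau>"
      using Suc by simp
    finally have rec: "?x l (Suc (Suc i))
      = (1 - \<tau>) * Bernstein i (k - l) \<tau> + ?y (Suc l) (Suc i)"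
      by (simp add: algebra_simps)
    show ?case
    proof (cases "l = k")
      case True
      then have "?y (Suc l) (Suc i) = 0"
        using P by (auto simp: polytope_P_def is_array_def)
      then show ?thesis using rec True by (simp add: Bernstein_Suc_0)
    next
      case False
      then have l: "Suc l \<in> {1..k}" "k - l = Suc (k - Suc l)" using Suc.prems(2) by auto
      have "?y (Suc l) (Suc i) = \<tau> * ?x (Suc l) (Suc i)"
        using static_y_eq assms(1,2) n i(2) l(1) by blast
      also have "?x (Suc l) (Suc i) = Bernstein i (k - Suc l) \<tau>"
        using Suc l by simp
      finally show ?thesis using rec l(2) by (simp add: Bernstein_Suc_Suc)
    qed
  qed
qed

lemma static_value_eq:
  assumes "1 \<le> k" "1 \<le> n" "\<tau> \<in> {0<..1}"
  shows "static_value k n \<tau> q = min \<tau> q * active_time n k \<tau>"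
proof -
  have "static_value k n \<tau> q = (\<Sum>i=1..n. \<Sum>l=1..k. min \<tau> q * Bernstein (i - 1) (k - l) \<tau>)"
    unfolding static_value_def
  proof (intro sum.cong refl)
    fix i l assume il: "i \<in> {1..n}" "l \<in> {1..k}"
    have x: "static_x k n \<tau> l i = Bernstein (i - 1) (k - l) \<tau>"
      using static_x_eq_Bernstein[of k \<tau> "i - 1" n l] assms il by auto
    have "0 \<le> static_x k n \<tau> l i" using x assms by (simp add: Bernstein_nonneg)
    then show "min (static_y k n \<tau> l i) (q * static_x k n \<tau> l i) =
        min \<tau> q * Bernstein (i - 1) (k - l) \<tau>"
      using static_y_eq[OF assms il] by (simp add: x min_mult_distrib_right)
  qed
  also have "\<dots> = min \<tau> q * (\<Sum>i<n. \<Sum>l<k. Bernstein i (k - Suc l) \<tau>)"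
    by (simp add: sum.atLeast1_atMost_eq sum_distrib_left)
  \<comment> \<open>Reversing the inner sum passes from remaining to consumed units.\<close>
  also have "\<dots> = min \<tau> q * active_time n k \<tau>"
    unfolding active_time_def binomial_head_def
    by (simp add: sum.nat_diff_reindex[of "\<lambda>j. Bernstein _ j \<tau>"])
  finally show ?thesis .
qed

section \<open>Closed forms of the two programs\<close>

text \<open>A dual certificate: \<alpha> weighs the limit constraint at 0 and \<beta> the constraint
  at 1. It is the tangent at \<open>k / n\<close> rescaled by the claimed optimum.\<close>

lemma active_time_multipliers:
  assumes "1 \<le> k" "k < n"
  obtains \<alpha> \<beta> where "0 \<le> \<alpha>" "0 \<le> \<beta>" "\<alpha> * real n + \<beta> * real k = 1"
    "\<And>x. 0 < x \<Longrightarrow> x \<le> 1 \<Longrightarrow> (\<alpha> + \<beta> * x) * active_time n k x \<le> active_time n k (k / n) / n"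
proof -
  let ?t = "real k / real n"
  let ?c = "active_time n k ?t / n"
  have t: "0 < ?t" "?t < 1" using assms by auto
  have c: "0 \<le> ?c" using assms t active_time_pos[of k n ?t] by (simp add: less_imp_le)
  obtain a b where ab: "0 \<le> a" "0 \<le> b" "(a + b * ?t) * active_time n k ?t = 1"
    and le1: "\<And>x. 0 < x \<Longrightarrow> x \<le> 1 \<Longrightarrow> (a + b * x) * active_time n k x \<le> 1"
    using inverse_active_time_tangent[OF assms t] by blast
  show thesis
  proof (rule that[of "?c * a" "?c * b"])
    have "?c * a * real n + ?c * b * real k = (a + b * ?t) * active_time n k ?t"
      using assms by (simp add: field_simps)
    then show "?c * a * real n + ?c * b * real k = 1" using ab by simp
    fix x :: real assume "0 < x" "x \<le> 1"
    from mult_left_mono[OF le1[OF this] c]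
    show "(?c * a + ?c * b * x) * active_time n k x \<le> ?c" by (simp add: algebra_simps)
  qed (use mult_nonneg_nonneg[OF c] ab in blast)+
qed

text \<open>The upper bounds on \<open>Q\<close> make the minimum feasible; \<open>Q_1\<close> and
  the limit \<open>Q_0\<close> show that nothing larger is.\<close>

lemma iidLP_OST_eq:
  assumes kn: "1 \<le> k" "k < n" and \<tau>: "\<tau> \<in> {0<..1}"
    and Q_n: "\<And>q. q \<in> {0<..1} \<Longrightarrow> Q k n q \<le> real n * q"
    and Q_k: "\<And>q. q \<in> {0<..1} \<Longrightarrow> Q k n q \<le> real k"
    and Q_1: "Q k n 1 = real k"
    and Q_0: "((\<lambda>q. Q k n q / q) \<longlongrightarrow> real n) (at_right 0)"
  shows "iidLP_OST Q k n \<tau> = min (active_time n k \<tau> / n) (\<tau> * active_time n k \<tau> / k)"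
  unfolding iidLP_OST_def
proof (rule Greatest_equality)
  let ?S = "active_time n k \<tau>"
  let ?m = "min (?S / n) (\<tau> * ?S / k)"
  have val: "static_value k n \<tau> q = min \<tau> q * ?S" for q
    using kn \<tau> by (intro static_value_eq) auto
  have S: "0 < ?S" using kn \<tau> by (intro active_time_pos) auto
  show "\<forall>q\<in>{0<..1}. ?m * Q k n q \<le> static_value k n \<tau> q"
  proof
    fix q :: real assume q: "q \<in> {0<..1}"
    have m: "0 \<le> ?m" using S \<tau> by simp
    have "?m * Q k n q \<le> ?m * (real n * q)" "?m * Q k n q \<le> ?m * real k"
      using m Q_n[OF q] Q_k[OF q] by (auto intro: mult_left_mono)
    moreover have "?m * (real n * q) \<le> ?S / n * (real n * q)" "?m * real k \<le> \<tau> * ?S / k * real k"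
      using q by (intro mult_right_mono; simp)+
    ultimately have "?m * Q k n q \<le> q * ?S" "?m * Q k n q \<le> \<tau> * ?S"
      using kn by (auto simp: mult.commute)
    then show "?m * Q k n q \<le> static_value k n \<tau> q"
      by (simp add: val min_def)
  qed
  fix \<theta> assume \<theta>: "\<forall>q\<in>{0<..1}. \<theta> * Q k n q \<le> static_value k n \<tau> q"
  have "\<theta> * real k \<le> \<tau> * ?S"
    using bspec[OF \<theta>, of 1] \<tau> by (simp add: val Q_1)
  then have "\<theta> \<le> \<tau> * ?S / k" using kn by (simp add: field_simps)
  moreover have "\<theta> * real n \<le> ?S"
  proof (rule tendsto_upperbound)
    show "((\<lambda>q. \<theta> * (Q k n q / q)) \<longlongrightarrow> \<theta> * real n) (at_right 0)"
      by (intro tendsto_intros Q_0)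
    show "\<forall>\<^sub>F q in at_right 0. \<theta> * (Q k n q / q) \<le> ?S"
      using eventually_at_right_real[OF zero_less_one]
    proof eventually_elim
      case (elim q)
      then have "\<theta> * Q k n q \<le> min \<tau> q * ?S"
        using bspec[OF \<theta>, of q] by (simp add: val)
      also have "\<dots> \<le> q * ?S" using S by (intro mult_right_mono) auto
      finally show ?case using elim by (simp add: field_simps)
    qed
  qed simp
  ultimately show "\<theta> \<le> ?m" using kn by (simp add: field_simps)
qed

text \<open>The point mass at \<open>k / n\<close> attains the value; the multipliers bound every
  mixture by integrating a pointwise inequality.\<close>

lemma iidLP_ST_eq:
  assumes kn: "1 \<le> k" "k < n"
    and Q_n: "\<And>q. q \<in> {0<..1} \<Longrightarrow> Q k n q \<le> real n * q"
    and Q_k: "\<And>q. q \<in> {0<..1} \<Longrightarrow> Q k n q \<le> real k"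
    and Q_1: "Q k n 1 = real k"
    and Q_0: "((\<lambda>q. Q k n q / q) \<longlongrightarrow> real n) (at_right 0)"
  shows "iidLP_ST Q k n = active_time n k (k / n) / n"
  unfolding iidLP_ST_def
proof (rule cSup_eq_maximum, goal_cases)
  let ?S = "active_time n k" and ?M = "restrict_space borel {0<..1::real}"
  let ?t = "real k / real n"
  have t: "0 < ?t" "?t < 1" using kn by auto
  have val: "static_value k n \<tau> q = min \<tau> q * ?S \<tau>" if "\<tau> \<in> {0<..1}" for \<tau> q
    using kn that by (intro static_value_eq) auto
  have [measurable]: "?S \<in> borel_measurable borel"
    by (intro borel_measurable_continuous_onI continuous_on_active_time)
  have meas: "f \<in> borel_measurable ?M" if "f \<in> borel_measurable borel" for f :: "real \<Rightarrow> real"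
    using that by (rule measurable_restrict_space1)
  {
    case 1
    let ?\<mu> = "return ?M ?t"
    have sp: "?t \<in> space ?M" using t by (simp add: space_restrict_space)
    have "(\<integral>\<tau>. static_value k n \<tau> q \<partial>?\<mu>) = static_value k n ?t q" for q
    proof (rule integral_return[OF sp])
      have "(\<lambda>\<tau>. min \<tau> q * ?S \<tau>) \<in> borel_measurable ?M" by (rule meas) measurable
      \<comment> \<open>Measurability transfers from the closed form, which is available on
        (0,1].\<close>
      then show "(\<lambda>\<tau>. static_value k n \<tau> q) \<in> borel_measurable ?M"
        by (rule measurable_cong[THEN iffD1, rotated]) (simp add: val space_restrict_space)
    qed
    moreover have "?S ?t / n * Q k n q \<le> static_value k n ?t q" if q: "q \<in> {0<..1}" for q
    proof -
      \<comment> \<open>At \<open>k / n\<close> the bounds through n q and through k become exactly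
        q S and \<tau> S.\<close>
      have S: "0 < ?S ?t" using kn t by (intro active_time_pos) auto
      then have "?S ?t / n * Q k n q \<le> ?S ?t / n * (real n * q)"
        "?S ?t / n * Q k n q \<le> ?S ?t / n * real k"
        using Q_n[OF q] Q_k[OF q] by (intro mult_left_mono; simp)+
      then show ?thesis using kn t by (auto simp: val min_def mult.commute)
    qed
    ultimately show ?case
      by (intro CollectI exI[of _ ?\<mu>]) (auto intro!: prob_space_return sp)
  next
    case (2 \<theta>)
    then obtain \<mu> :: "real measure" where "prob_space \<mu>"
      and sets: "sets \<mu> = sets ?M"
      and \<theta>: "\<And>q. q \<in> {0<..1} \<Longrightarrow> \<theta> * Q k n q \<le> (\<integral>\<tau>. static_value k n \<tau> q \<partial>\<mu>)"
      by auto
    interpret prob_space \<mu> by fact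
    have space: "space \<mu> = {0<..1}"
      using sets_eq_imp_space_eq[OF sets] by (simp add: space_restrict_space)
    have S: "0 < ?S \<tau>" "?S \<tau> \<le> real n" if "\<tau> \<in> {0<..1}" for \<tau>
      using kn that by (auto intro: active_time_pos active_time_le)
    have int: "integrable \<mu> f"
      if "f \<in> borel_measurable borel" "\<And>\<tau>. \<tau> \<in> {0<..1} \<Longrightarrow> \<bar>f \<tau>\<bar> \<le> real n" for f
    proof (rule integrable_const_bound)
      show "f \<in> borel_measurable \<mu>"
        using meas[OF that(1)] measurable_cong_sets[OF sets refl] by blast
      show "AE \<tau> in \<mu>. norm (f \<tau>) \<le> real n"
        using that(2) by (intro AE_I2) (simp add: space)
    qed
    have int_S: "integrable \<mu> ?S"
      using S by (intro int) (simp_all add: abs_of_pos)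
    have min_S: "\<bar>min \<tau> q * ?S \<tau>\<bar> \<le> real n" if "\<tau> \<in> {0<..1}" "q \<in> {0<..1}" for \<tau> q
      using S[OF that(1)] mult_mono[of "min \<tau> q" 1 "?S \<tau>" "real n"] that
      by (simp add: abs_mult min_le_iff_disj)
    have int_min: "integrable \<mu> (\<lambda>\<tau>. min \<tau> q * ?S \<tau>)" if "q \<in> {0<..1}" for q
      using min_S that by (intro int) auto
    have \<theta>': "\<theta> * Q k n q \<le> (\<integral>\<tau>. min \<tau> q * ?S \<tau> \<partial>\<mu>)" if q: "q \<in> {0<..1}" for q
      using \<theta>[OF q] Bochner_Integration.integral_cong[OF refl, of \<mu>
          "\<lambda>\<tau>. static_value k n \<tau> q" "\<lambda>\<tau>. min \<tau> q * ?S \<tau>"]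
      by (simp add: val space)
    have \<theta>_n: "\<theta> * real n \<le> (\<integral>\<tau>. ?S \<tau> \<partial>\<mu>)"
    proof (rule tendsto_upperbound)
      show "((\<lambda>q. \<theta> * (Q k n q / q)) \<longlongrightarrow> \<theta> * real n) (at_right 0)"
        by (intro tendsto_intros Q_0)
      show "\<forall>\<^sub>F q in at_right 0. \<theta> * (Q k n q / q) \<le> (\<integral>\<tau>. ?S \<tau> \<partial>\<mu>)"
        using eventually_at_right_real[OF zero_less_one]
      proof eventually_elim
        case (elim q)
        then have q: "q \<in> {0<..1}" by auto
        have "\<theta> * Q k n q \<le> (\<integral>\<tau>. min \<tau> q * ?S \<tau> \<partial>\<mu>)" by (rule \<theta>'[OF q])
        \<comment> \<open>After division by \<open>q\<close> the right side is constant, so only the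
          left side passes to the limit.\<close>
        also have "\<dots> \<le> (\<integral>\<tau>. q * ?S \<tau> \<partial>\<mu>)"
          using int_min[OF q] int_S S
          by (intro integral_mono) (auto simp: space intro!: mult_right_mono less_imp_le)
        finally show ?case using q by (simp add: field_simps)
      qed
    qed simp
    have \<theta>_k: "\<theta> * real k \<le> (\<integral>\<tau>. min \<tau> 1 * ?S \<tau> \<partial>\<mu>)"
      using \<theta>'[of 1] by (simp add: Q_1)
    obtain \<alpha> \<beta> where ab: "0 \<le> \<alpha>" "0 \<le> \<beta>" "\<alpha> * real n + \<beta> * real k = 1"
      and le: "\<And>x. 0 < x \<Longrightarrow> x \<le> 1 \<Longrightarrow> (\<alpha> + \<beta> * x) * ?S x \<le> ?S ?t / n"
      using active_time_multipliers[OF kn] by blast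
    \<comment> \<open>The normalization of \<alpha> and \<beta> recovers \<theta> from the two
      constraints.\<close>
    have "\<theta> * (\<alpha> * real n + \<beta> * real k) = \<alpha> * (\<theta> * real n) + \<beta> * (\<theta> * real k)"
      by (simp add: algebra_simps)
    then have "\<theta> = \<alpha> * (\<theta> * real n) + \<beta> * (\<theta> * real k)" using ab(3) by simp
    also have "\<dots> \<le> \<alpha> * (\<integral>\<tau>. ?S \<tau> \<partial>\<mu>) + \<beta> * (\<integral>\<tau>. min \<tau> 1 * ?S \<tau> \<partial>\<mu>)"
      using \<theta>_n \<theta>_k ab by (intro add_mono mult_left_mono)
    also have "\<dots> = (\<integral>\<tau>. \<alpha> * ?S \<tau> + \<beta> * (min \<tau> 1 * ?S \<tau>) \<partial>\<mu>)"
      using int_S int_min[of 1] by simp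
    also have "\<dots> \<le> (\<integral>\<tau>. ?S ?t / n \<partial>\<mu>)"
      using int_S int_min[of 1] le
      by (intro integral_mono) (auto simp: space algebra_simps min_absorb1)
    finally show ?case by (simp add: prob_space)
  }
qed

text \<open>The same multipliers bound each deterministic policy, and \<open>k / n\<close> again
  attains the bound.\<close>

lemma iidLP_ST_eq_SUP_OST:
  assumes kn: "1 \<le> k" "k < n"
    and Q_n: "\<And>q. q \<in> {0<..1} \<Longrightarrow> Q k n q \<le> real n * q"
    and Q_k: "\<And>q. q \<in> {0<..1} \<Longrightarrow> Q k n q \<le> real k"
    and Q_1: "Q k n 1 = real k"
    and Q_0: "((\<lambda>q. Q k n q / q) \<longlongrightarrow> real n) (at_right 0)"
  shows "iidLP_ST Q k n = (SUP \<tau>\<in>{0<..1}. iidLP_OST Q k n \<tau>)"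
proof -
  let ?S = "active_time n k"
  let ?t = "real k / real n"
  have t: "0 < ?t" "?t < 1" using kn by auto
  have OST: "iidLP_OST Q k n \<tau> = min (?S \<tau> / n) (\<tau> * ?S \<tau> / k)" if "\<tau> \<in> {0<..1}" for \<tau>
    using iidLP_OST_eq[OF kn that, of Q] Q_n Q_k Q_1 Q_0 by blast
  obtain \<alpha> \<beta> where ab: "0 \<le> \<alpha>" "0 \<le> \<beta>" "\<alpha> * real n + \<beta> * real k = 1"
    and le: "\<And>x. 0 < x \<Longrightarrow> x \<le> 1 \<Longrightarrow> (\<alpha> + \<beta> * x) * ?S x \<le> ?S ?t / n"
    using active_time_multipliers[OF kn] by blast
  have "(SUP \<tau>\<in>{0<..1}. iidLP_OST Q k n \<tau>) = ?S ?t / n"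
  proof (rule cSup_eq_maximum)
    show "?S ?t / n \<in> iidLP_OST Q k n ` {0<..1}"
      using kn t by (intro image_eqI[of _ _ ?t]) (auto simp: OST)
  next
    fix \<theta> assume "\<theta> \<in> iidLP_OST Q k n ` {0<..1}"
    then obtain \<tau> where \<tau>: "\<tau> \<in> {0<..1}" and "\<theta> = min (?S \<tau> / n) (\<tau> * ?S \<tau> / k)"
      by (auto simp: OST)
    then have "\<theta> * real n \<le> ?S \<tau>" "\<theta> * real k \<le> \<tau> * ?S \<tau>"
      using kn by (auto simp: min_le_iff_disj simp flip: pos_le_divide_eq)
    then have "\<alpha> * (\<theta> * real n) + \<beta> * (\<theta> * real k) \<le> \<alpha> * ?S \<tau> + \<beta> * (\<tau> * ?S \<tau>)"
      using ab by (intro add_mono mult_left_mono)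
    also have "\<dots> = (\<alpha> + \<beta> * \<tau>) * ?S \<tau>" by (simp add: algebra_simps)
    also have "\<dots> \<le> ?S ?t / n" using le \<tau> by simp
    also have "\<alpha> * (\<theta> * real n) + \<beta> * (\<theta> * real k) = \<theta> * (\<alpha> * real n + \<beta> * real k)"
      by (simp add: algebra_simps)
    finally show "\<theta> \<le> ?S ?t / n" by (simp add: ab(3))
  qed
  then show ?thesis using iidLP_ST_eq[OF kn, of Q] Q_n Q_k Q_1 Q_0 by simp
qed

section \<open>The two benchmarks\<close>

lemma Q_Proph_eq: "q \<in> {0<..1} \<Longrightarrow> Q_Proph k n q = expected_min n k q"
  unfolding Q_Proph_def expected_min_def
  by (subst expectation_binomial_pmf') (auto simp: Bernstein_def mult.commute intro!: sum.cong)

theorem corollary2: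
  fixes k n :: nat
  assumes "1 \<le> k" and "k < n"
  shows "iidLP_ST Q_Proph k n = (SUP \<tau>\<in>{0<..1}. iidLP_OST Q_Proph k n \<tau>) \<and>
         iidLP_ST Q_ExAnte k n = (SUP \<tau>\<in>{0<..1}. iidLP_OST Q_ExAnte k n \<tau>)"
proof
  show "iidLP_ST Q_Proph k n = (SUP \<tau>\<in>{0<..1}. iidLP_OST Q_Proph k n \<tau>)"
  proof (rule iidLP_ST_eq_SUP_OST[where Q = Q_Proph, OF assms])
    fix q :: real assume q: "q \<in> {0<..1}"
    show "Q_Proph k n q \<le> real n * q"
      using active_time_le[of q n k] q
      by (simp add: Q_Proph_eq expected_min_eq_active_time mult.commute)
    show "Q_Proph k n q \<le> real k"
      using q by (simp add: Q_Proph_eq expected_min_le)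
  next
    show "Q_Proph k n 1 = real k"
      using assms by (simp add: Q_Proph_eq expected_min_1)
  next
    \<comment> \<open>The ratio Q(q)/q is S(q) for 0 < q < 1, so its limit is S(0) = n.\<close>
    have "(active_time n k \<longlongrightarrow> active_time n k 0) (at_right 0)"
      using continuous_on_active_time[of UNIV n k]
      by (auto simp: continuous_on_def intro: tendsto_within_subset)
    moreover have "\<forall>\<^sub>F q in at_right 0. active_time n k q = Q_Proph k n q / q"
      using eventually_at_right_real[OF zero_less_one]
      by (rule eventually_mono) (simp_all add: Q_Proph_eq expected_min_eq_active_time)
    ultimately show "((\<lambda>q. Q_Proph k n q / q) \<longlongrightarrow> real n) (at_right 0)"
      using assms by (simp add: active_time_0 tendsto_cong)
  qed
  show "iidLP_ST Q_ExAnte k n = (SUP \<tau>\<in>{0<..1}. iidLP_OST Q_ExAnte k n \<tau>)"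
  proof (rule iidLP_ST_eq_SUP_OST[where Q = Q_ExAnte, OF assms])
    have "0 < real k / real n" using assms by simp
    \<comment> \<open>Below \<open>k / n\<close> the minimum is attained by n q.\<close>
    then have "\<forall>\<^sub>F q in at_right 0. Q_ExAnte k n q / q = real n"
      by (rule eventually_mono[OF eventually_at_right_real])
        (use assms in \<open>simp add: Q_ExAnte_def field_simps\<close>)
    then show "((\<lambda>q. Q_ExAnte k n q / q) \<longlongrightarrow> real n) (at_right 0)"
      by (rule tendsto_eventually)
  qed (use assms in \<open>auto simp: Q_ExAnte_def\<close>)
qed

end
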